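(* Let $\mathcal A$ be a set, $F=\mathcal A\times(\cdot)+1$ ($1=\{\bullet\}$), and let $\alpha:X\to\mathcal P(\mathcal A\times X+1)$ be a nondeterministic automaton, viewed as a $\bar F$-coalgebra in $\mathbf{Rel}\cong\mathbf{Kl}(\mathcal P)$. Let $\simeq_X\subseteq\mathcal PX\times\mathcal PX$ be language equivalence on the determinised system. Then $$\simeq_X\ \subseteq\ (|\alpha|\times|\alpha|)^{-1}\big(\bar\lambda_X(\simeq_X)\big).$$ Moreover, for every $\bar F$-coalgebra homomorphism $f:(X,\alpha)\to(Y,\beta)$ in $\mathbf{Kl}(\mathcal P)$ we have $\simeq_X=(|f|\times|f|)^{-1}(\simeq_Y)$; consequently, sending each coalgebra $(X,\alpha)$ to the greatest relation $R\subseteq\mathcal PX\times\mathcal PX$ with $R\subseteq(|\alpha|\times|\alpha|)^{-1}(\bar\lambda_XR)$, and each homomorphism to itself, defines a functor (the behavioural conformance functor) from $\bar F$-coalgebras in $\mathbf{Kl}(\mathcal P)$ to pairs $((X,\alpha),R)$ with $R\subseteq(|\alpha|\times|\alpha|)^{-1}(\bar\lambda_XR)$.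
   Context: $\mathbf{Kl}(\mathcal P)$: morphisms $X\to Y$ are functions $X\to\mathcal PY$; $|X|=\mathcal PX$ and $|f|(U)=\bigcup_{x\in U}f(x)$. The distributive law $\vartheta_X:\mathcal A\times\mathcal PX+1\to\mathcal P(\mathcal A\times X+1)$ is $(a,U)\mapsto\{a\}\times U$, $\bullet\mapsto\{\bullet\}$, and $\bar F$ is $\bar FX=FX$, $\bar Ff=\vartheta_Y\circ Ff$; a homomorphism $f:(X,\alpha)\to(Y,\beta)$ satisfies $\bar Ff\circ\alpha=\beta\circ f$ (Kleisli composition). The determinised system on $\mathcal PX$: $U\xrightarrow{a}U_a=\{x'\mid\exists x\in U:(a,x')\in\alpha(x)\}$, and $U\!\downarrow$ iff $\exists x\in U:\bullet\in\alpha(x)$; extend to words by $U_\varepsilon=U$, $U_{aw}=(U_a)_w$. Language equivalence: $U\simeq_XU'$ iff for all $w\in\mathcal A^*$, $U_w\!\downarrow\Leftrightarrow U'_w\!\downarrow$. For $R\subseteq\mathcal PX\times\mathcal PX$, $\bar\lambda_X(R)\subseteq\mathcal P(FX)\times\mathcal P(FX)$ is: $\bar U\mathrel{\bar\lambda_XR}\bar U'$ iff ($\bullet\in\bar U\Leftrightarrow\bullet\in\bar U'$) and for all $a$, $\{x\mid(a,x)\in\bar U\}\mathrel R\{x\mid(a,x)\in\bar U'\}$. A morphism of the target category $((X,\alpha),R)\to((Y,\beta),S)$ is a coalgebra homomorphism $f$ with $R\subseteq(|f|\times|f|)^{-1}S$. *)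

theory Defs
  imports Main "HOL-Library.FuncSet"
begin

section \<open>Categories and functors\<close>

text \<open>Hom-sets of different pairs of objects need not be disjoint, so composition and the
  morphism part of a functor receive the objects as explicit arguments.\<close>

record ('o, 'm) cat =
  Obj :: "'o set"
  Hom :: "'o \<Rightarrow> 'o \<Rightarrow> 'm set"
  Ident :: "'o \<Rightarrow> 'm"
  Comp :: "'o \<Rightarrow> 'o \<Rightarrow> 'o \<Rightarrow> 'm \<Rightarrow> 'm \<Rightarrow> 'm"

locale category =
  fixes C :: "('o, 'm) cat"
  assumes ident_hom: "x \<in> Obj C \<Longrightarrow> Ident C x \<in> Hom C x x"
    and comp_hom: "\<lbrakk>x \<in> Obj C; y \<in> Obj C; z \<in> Obj C; f \<in> Hom C x y; g \<in> Hom C y z\<rbrakk>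
      \<Longrightarrow> Comp C x y z g f \<in> Hom C x z"
    and comp_ident_right: "\<lbrakk>x \<in> Obj C; y \<in> Obj C; f \<in> Hom C x y\<rbrakk>
      \<Longrightarrow> Comp C x x y f (Ident C x) = f"
    and comp_ident_left: "\<lbrakk>x \<in> Obj C; y \<in> Obj C; f \<in> Hom C x y\<rbrakk>
      \<Longrightarrow> Comp C x y y (Ident C y) f = f"
    and comp_assoc: "\<lbrakk>w \<in> Obj C; x \<in> Obj C; y \<in> Obj C; z \<in> Obj C;
        f \<in> Hom C w x; g \<in> Hom C x y; h \<in> Hom C y z\<rbrakk>
      \<Longrightarrow> Comp C w x z (Comp C x y z h g) f = Comp C w y z h (Comp C w x y g f)"

locale cat_functor = source: category C + target: category D
  for C :: "('o, 'm) cat" and D :: "('p, 'n) cat" +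
  fixes FO :: "'o \<Rightarrow> 'p" and FM :: "'o \<Rightarrow> 'o \<Rightarrow> 'm \<Rightarrow> 'n"
  assumes map_obj: "x \<in> Obj C \<Longrightarrow> FO x \<in> Obj D"
    and map_hom: "\<lbrakk>x \<in> Obj C; y \<in> Obj C; f \<in> Hom C x y\<rbrakk>
      \<Longrightarrow> FM x y f \<in> Hom D (FO x) (FO y)"
    and map_ident: "x \<in> Obj C \<Longrightarrow> FM x x (Ident C x) = Ident D (FO x)"
    and map_comp: "\<lbrakk>x \<in> Obj C; y \<in> Obj C; z \<in> Obj C; f \<in> Hom C x y; g \<in> Hom C y z\<rbrakk>
      \<Longrightarrow> FM x z (Comp C x y z g f) = Comp D (FO x) (FO y) (FO z) (FM y z g) (FM x y f)"

section \<open>The Kleisli category of the powerset monad\<close>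

text \<open>Carriers are sets \<open>X :: 'x set\<close>; a Kleisli morphism \<open>X \<rightarrow> Y\<close> is an extensional function
  (\<open>undefined\<close> outside \<open>X\<close>), so that equality in HOL is equality of morphisms.\<close>

definition kl_hom :: "'x set \<Rightarrow> 'y set \<Rightarrow> ('x \<Rightarrow> 'y set) set" where
  "kl_hom X Y = X \<rightarrow>\<^sub>E Pow Y"

definition kl_id :: "'x set \<Rightarrow> 'x \<Rightarrow> 'x set" where
  "kl_id X = (\<lambda>x\<in>X. {x})"

definition kl_comp :: "'x set \<Rightarrow> ('y \<Rightarrow> 'z set) \<Rightarrow> ('x \<Rightarrow> 'y set) \<Rightarrow> 'x \<Rightarrow> 'z set" where
  "kl_comp X g f = (\<lambda>x\<in>X. \<Union>y\<in>f x. g y)"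

definition kl_ext :: "('x \<Rightarrow> 'y set) \<Rightarrow> 'x set \<Rightarrow> 'y set" where
  "kl_ext f U = (\<Union>x\<in>U. f x)"

definition rel_preimage ::
  "'x set \<Rightarrow> ('x \<Rightarrow> 'y set) \<Rightarrow> ('y set \<times> 'y set) set \<Rightarrow> ('x set \<times> 'x set) set" where
  "rel_preimage X f S = map_prod (kl_ext f) (kl_ext f) -` S \<inter> (Pow X \<times> Pow X)"

section \<open>Nondeterministic automata as coalgebras\<close>

text \<open>\<open>Inr ()\<close> plays the role of the termination symbol \<open>\<bullet>\<close>.\<close>

type_synonym ('a, 'x) autF = "('a \<times> 'x) + unit"

definition F_obj :: "'a set \<Rightarrow> 'x set \<Rightarrow> ('a, 'x) autF set" where
  "F_obj A X = (A \<times> X) <+> {()}"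

definition F_map :: "('x \<Rightarrow> 'y) \<Rightarrow> ('a, 'x) autF \<Rightarrow> ('a, 'y) autF" where
  "F_map f = map_sum (map_prod id f) id"

fun dist_law :: "('a, 'x set) autF \<Rightarrow> ('a, 'x) autF set" where
  "dist_law (Inl (a, U)) = Inl ` ({a} \<times> U)"
| "dist_law (Inr u) = {Inr u}"

definition Fbar_map ::
  "'a set \<Rightarrow> 'x set \<Rightarrow> ('x \<Rightarrow> 'y set) \<Rightarrow> ('a, 'x) autF \<Rightarrow> ('a, 'y) autF set" where
  "Fbar_map A X f = restrict (dist_law \<circ> F_map f) (F_obj A X)"

type_synonym ('a, 'x) coalg = "'x set \<times> ('x \<Rightarrow> ('a, 'x) autF set)"

definition coalgs :: "'a set \<Rightarrow> ('a, 'x) coalg set" where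
  "coalgs A = {(X, \<alpha>). \<alpha> \<in> kl_hom X (F_obj A X)}"

fun coalg_hom :: "'a set \<Rightarrow> ('a, 'x) coalg \<Rightarrow> ('a, 'y) coalg \<Rightarrow> ('x \<Rightarrow> 'y set) set" where
  "coalg_hom A (X, \<alpha>) (Y, \<beta>) =
     {f \<in> kl_hom X Y. kl_comp X (Fbar_map A X f) \<alpha> = kl_comp X \<beta> f}"

definition coalg_cat :: "'a set \<Rightarrow> (('a, 'x) coalg, 'x \<Rightarrow> 'x set) cat" where
  "coalg_cat A = \<lparr>Obj = coalgs A, Hom = coalg_hom A, Ident = \<lambda>c. kl_id (fst c),
     Comp = \<lambda>c _ _ g f. kl_comp (fst c) g f\<rparr>"

section \<open>Determinisation and language equivalence\<close>

definition det_step :: "('x \<Rightarrow> ('a, 'x) autF set) \<Rightarrow> 'x set \<Rightarrow> 'a \<Rightarrow> 'x set" where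
  "det_step \<alpha> U a = {x'. \<exists>x\<in>U. Inl (a, x') \<in> \<alpha> x}"

fun det_word :: "('x \<Rightarrow> ('a, 'x) autF set) \<Rightarrow> 'x set \<Rightarrow> 'a list \<Rightarrow> 'x set" where
  "det_word \<alpha> U [] = U"
| "det_word \<alpha> U (a # w) = det_word \<alpha> (det_step \<alpha> U a) w"

definition det_term :: "('x \<Rightarrow> ('a, 'x) autF set) \<Rightarrow> 'x set \<Rightarrow> bool" where
  "det_term \<alpha> U \<longleftrightarrow> (\<exists>x\<in>U. Inr () \<in> \<alpha> x)"

definition lang_eq ::
  "'a set \<Rightarrow> 'x set \<Rightarrow> ('x \<Rightarrow> ('a, 'x) autF set) \<Rightarrow> ('x set \<times> 'x set) set" where
  "lang_eq A X \<alpha> = {(U, U'). U \<subseteq> X \<and> U' \<subseteq> X \<and>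
     (\<forall>w\<in>lists A. det_term \<alpha> (det_word \<alpha> U w) \<longleftrightarrow> det_term \<alpha> (det_word \<alpha> U' w))}"

section \<open>Conformances\<close>

definition lam_bar :: "'a set \<Rightarrow> 'x set \<Rightarrow> ('x set \<times> 'x set) set
    \<Rightarrow> (('a, 'x) autF set \<times> ('a, 'x) autF set) set" where
  "lam_bar A X R = {(V, V'). V \<subseteq> F_obj A X \<and> V' \<subseteq> F_obj A X \<and>
     (Inr () \<in> V \<longleftrightarrow> Inr () \<in> V') \<and>
     (\<forall>a\<in>A. ({x. Inl (a, x) \<in> V}, {x. Inl (a, x) \<in> V'}) \<in> R)}"

definition conformance ::
  "'a set \<Rightarrow> 'x set \<Rightarrow> ('x \<Rightarrow> ('a, 'x) autF set) \<Rightarrow> ('x set \<times> 'x set) set \<Rightarrow> bool" where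
  "conformance A X \<alpha> R \<longleftrightarrow>
     R \<subseteq> Pow X \<times> Pow X \<and> R \<subseteq> rel_preimage X \<alpha> (lam_bar A X R)"

definition beh_conf ::
  "'a set \<Rightarrow> 'x set \<Rightarrow> ('x \<Rightarrow> ('a, 'x) autF set) \<Rightarrow> ('x set \<times> 'x set) set" where
  "beh_conf A X \<alpha> = (GREATEST R. conformance A X \<alpha> R)"

type_synonym ('a, 'x) conf_coalg = "('a, 'x) coalg \<times> ('x set \<times> 'x set) set"

definition conf_coalgs :: "'a set \<Rightarrow> ('a, 'x) conf_coalg set" where
  "conf_coalgs A = {((X, \<alpha>), R). (X, \<alpha>) \<in> coalgs A \<and> conformance A X \<alpha> R}"

fun conf_hom ::
  "'a set \<Rightarrow> ('a, 'x) conf_coalg \<Rightarrow> ('a, 'y) conf_coalg \<Rightarrow> ('x \<Rightarrow> 'y set) set" where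
  "conf_hom A ((X, \<alpha>), R) ((Y, \<beta>), S) =
     {f \<in> coalg_hom A (X, \<alpha>) (Y, \<beta>). R \<subseteq> rel_preimage X f S}"

definition conf_cat :: "'a set \<Rightarrow> (('a, 'x) conf_coalg, 'x \<Rightarrow> 'x set) cat" where
  "conf_cat A = \<lparr>Obj = conf_coalgs A, Hom = conf_hom A, Ident = \<lambda>c. kl_id (fst (fst c)),
     Comp = \<lambda>c _ _ g f. kl_comp (fst (fst c)) g f\<rparr>"

end

theory Submission
  imports Defs
begin

text \<open>A coalgebra homomorphism \<open>f\<close> makes \<open>|f|\<close> a homomorphism of determinised systems: it commutes
  with \<open>det_step\<close> and preserves and reflects termination, so \<open>U\<close> and \<open>|f| U\<close> accept the same words.
  Hence language equivalence is stable under inverse image along \<open>|f|\<close>. A conformance is a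
  bisimulation on the determinised system, so language equivalence is the greatest one.\<close>

section \<open>Kleisli extension and the category laws of Kleisli composition\<close>

lemma kl_ext_subset:
  assumes "f \<in> kl_hom X Y" and "U \<subseteq> X"
  shows "kl_ext f U \<subseteq> Y"
  using assms unfolding kl_hom_def kl_ext_def by (blast dest: PiE_mem)

lemma kl_ext_id: "U \<subseteq> X \<Longrightarrow> kl_ext (kl_id X) U = U"
  by (auto simp: kl_ext_def kl_id_def)

lemma kl_ext_comp: "U \<subseteq> X \<Longrightarrow> kl_ext (kl_comp X g f) U = kl_ext g (kl_ext f U)"
  by (auto simp: kl_ext_def kl_comp_def)

lemma kl_id_hom: "kl_id X \<in> kl_hom X X"
  by (auto simp: kl_id_def kl_hom_def)

lemma kl_comp_hom:
  assumes "f \<in> kl_hom X Y" and "g \<in> kl_hom Y Z"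
  shows "kl_comp X g f \<in> kl_hom X Z"
proof -
  have "(\<Union>y\<in>f x. g y) \<subseteq> Z" if "x \<in> X" for x
    using assms that unfolding kl_hom_def by (blast dest: PiE_mem)
  then show ?thesis
    by (auto simp: kl_comp_def kl_hom_def)
qed

lemma kl_comp_id_right:
  assumes "f \<in> kl_hom X Y"
  shows "kl_comp X f (kl_id X) = f"
proof -
  have "kl_comp X f (kl_id X) = restrict f X"
    unfolding kl_comp_def by (rule restrict_ext) (simp add: kl_id_def)
  then show ?thesis
    using assms by (simp add: kl_hom_def PiE_restrict)
qed

lemma kl_comp_id_left:
  assumes "f \<in> kl_hom X Y"
  shows "kl_comp X (kl_id Y) f = f"
proof -
  have "(\<Union>y\<in>f x. kl_id Y y) = f x" if "x \<in> X" for x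
  proof -
    have "f x \<subseteq> Y"
      using assms that by (auto simp: kl_hom_def)
    then show ?thesis
      using kl_ext_id[of "f x" Y] by (simp add: kl_ext_def)
  qed
  then have "kl_comp X (kl_id Y) f = restrict f X"
    unfolding kl_comp_def by (rule restrict_ext)
  then show ?thesis
    using assms by (simp add: kl_hom_def PiE_restrict)
qed

text \<open>Morphisms are unspecified off their domain, so \<open>kl_comp X h g\<close> may only be
  evaluated inside \<open>X\<close>. As \<open>f x\<close> is a subset of \<open>X\<close>, the
  claim at \<open>x\<close> is \<open>kl_ext_comp\<close> for the set \<open>f x\<close>.\<close>

lemma kl_comp_assoc:
  assumes "f \<in> kl_hom W X"
  shows "kl_comp W (kl_comp X h g) f = kl_comp W h (kl_comp W g f)"
proof -
  have "(\<Union>y\<in>f x. kl_comp X h g y) = (\<Union>z\<in>(\<Union>y\<in>f x. g y). h z)" if "x \<in> W" for x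
  proof -
    have "f x \<subseteq> X"
      using assms that by (auto simp: kl_hom_def)
    then show ?thesis
      using kl_ext_comp[of "f x" X h g] by (simp add: kl_ext_def)
  qed
  then show ?thesis
    by (simp add: kl_comp_def[of W] restrict_def fun_eq_iff)
qed

section \<open>Language equivalence as the greatest conformance\<close>

lemma coalgs_structure: "(X, \<alpha>) \<in> coalgs A \<longleftrightarrow> \<alpha> \<in> kl_hom X (F_obj A X)"
  by (simp add: coalgs_def)

text \<open>Together with \<open>det_term_kl_ext\<close> this lets the determinised system be read
  off from \<open>kl_ext \<alpha> U\<close>, the set to which \<open>lam_bar\<close> is
  applied.\<close>

lemma det_step_kl_ext: "det_step \<alpha> U a = {x. Inl (a, x) \<in> kl_ext \<alpha> U}"
  by (auto simp: det_step_def kl_ext_def)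

lemma det_term_kl_ext: "det_term \<alpha> U \<longleftrightarrow> Inr () \<in> kl_ext \<alpha> U"
  by (auto simp: det_term_def kl_ext_def)

lemma det_step_subset:
  assumes "(X, \<alpha>) \<in> coalgs A" and "U \<subseteq> X"
  shows "det_step \<alpha> U a \<subseteq> X"
  using kl_ext_subset[of \<alpha> X "F_obj A X" U] assms
  by (auto simp: det_step_kl_ext coalgs_structure F_obj_def)

lemma in_rel_preimage:
  "(U, U') \<in> rel_preimage X f S \<longleftrightarrow> U \<subseteq> X \<and> U' \<subseteq> X \<and> (kl_ext f U, kl_ext f U') \<in> S"
  by (auto simp: rel_preimage_def)

text \<open>This is the one-step bisimulation condition on the determinised system. The carrier
  condition in \<open>lam_bar\<close> holds because \<open>kl_ext \<alpha>\<close> sends subsets of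
  \<open>X\<close> to subsets of \<open>F_obj A X\<close>.\<close>

lemma in_rel_preimage_lam_bar:
  assumes "(X, \<alpha>) \<in> coalgs A"
  shows "(U, U') \<in> rel_preimage X \<alpha> (lam_bar A X R) \<longleftrightarrow>
    U \<subseteq> X \<and> U' \<subseteq> X \<and> (det_term \<alpha> U \<longleftrightarrow> det_term \<alpha> U') \<and>
    (\<forall>a\<in>A. (det_step \<alpha> U a, det_step \<alpha> U' a) \<in> R)"
  using assms kl_ext_subset[of \<alpha> X "F_obj A X"]
  by (auto simp: in_rel_preimage lam_bar_def det_step_kl_ext det_term_kl_ext coalgs_structure)

lemma lang_eq_subset_preimage:
  assumes "(X, \<alpha>) \<in> coalgs A"
  shows "lang_eq A X \<alpha> \<subseteq> rel_preimage X \<alpha> (lam_bar A X (lang_eq A X \<alpha>))"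
proof (rule subrelI)
  fix U U' assume UU': "(U, U') \<in> lang_eq A X \<alpha>"
  then have sub: "U \<subseteq> X" "U' \<subseteq> X"
    and words: "\<And>w. w \<in> lists A \<Longrightarrow>
      det_term \<alpha> (det_word \<alpha> U w) \<longleftrightarrow> det_term \<alpha> (det_word \<alpha> U' w)"
    by (auto simp: lang_eq_def)
  \<comment> \<open>The words \<open>a # w\<close> test the successors under \<open>a\<close> on all
    words \<open>w\<close>; the empty word yields the termination condition below.\<close>
  have "(det_step \<alpha> U a, det_step \<alpha> U' a) \<in> lang_eq A X \<alpha>" if "a \<in> A" for a
    using words[of "a # _"] that det_step_subset[OF assms sub(1)] det_step_subset[OF assms sub(2)]
    by (simp add: lang_eq_def)
  then show "(U, U') \<in> rel_preimage X \<alpha> (lam_bar A X (lang_eq A X \<alpha>))"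
    using sub words[of "[]"] by (simp add: in_rel_preimage_lam_bar[OF assms])
qed

lemma conformance_lang_eq:
  assumes "(X, \<alpha>) \<in> coalgs A"
  shows "conformance A X \<alpha> (lang_eq A X \<alpha>)"
  unfolding conformance_def using lang_eq_subset_preimage[OF assms] by (auto simp: lang_eq_def)

text \<open>Related sets agree on termination and have related successors, so induction on the word
  shows that they accept the same words. The pair is generalised because each letter leads to
  another pair in \<open>R\<close>.\<close>

lemma conformance_subset_lang_eq:
  assumes "(X, \<alpha>) \<in> coalgs A" and "conformance A X \<alpha> R"
  shows "R \<subseteq> lang_eq A X \<alpha>"
proof (rule subrelI)
  have step: "U \<subseteq> X \<and> U' \<subseteq> X \<and> (det_term \<alpha> U \<longleftrightarrow> det_term \<alpha> U') \<and>
      (\<forall>a\<in>A. (det_step \<alpha> U a, det_step \<alpha> U' a) \<in> R)" if "(U, U') \<in> R" for U U'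
    using that assms(2) in_rel_preimage_lam_bar[OF assms(1), of U U' R]
    by (auto simp: conformance_def)
  fix U U' assume UU': "(U, U') \<in> R"
  have "det_term \<alpha> (det_word \<alpha> U w) \<longleftrightarrow> det_term \<alpha> (det_word \<alpha> U' w)" if "w \<in> lists A" for w
    using that UU'
  proof (induction w arbitrary: U U')
    case Nil
    then show ?case
      using step[of U U'] by simp
  next
    case (Cons a w)
    then have "(det_step \<alpha> U a, det_step \<alpha> U' a) \<in> R"
      using step[of U U'] by simp
    then show ?case
      using Cons.IH by simp
  qed
  then show "(U, U') \<in> lang_eq A X \<alpha>"
    using step[OF UU'] by (simp add: lang_eq_def)
qed

text \<open>The \<open>GREATEST\<close> in \<open>beh_conf\<close> is meaningful only once a
  greatest conformance exists; language equivalence is one, being a conformance that contains all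
  others.\<close>

lemma beh_conf_eq_lang_eq:
  assumes "(X, \<alpha>) \<in> coalgs A"
  shows "beh_conf A X \<alpha> = lang_eq A X \<alpha>"
  unfolding beh_conf_def
  by (intro Greatest_equality conformance_lang_eq conformance_subset_lang_eq assms)

lemma conformance_beh_conf: "(X, \<alpha>) \<in> coalgs A \<Longrightarrow> conformance A X \<alpha> (beh_conf A X \<alpha>)"
  by (simp add: beh_conf_eq_lang_eq conformance_lang_eq)

section \<open>Coalgebra homomorphisms and the determinised system\<close>

lemma in_Fbar_map:
  assumes "t \<in> F_obj A X"
  shows "Inl (a, y) \<in> Fbar_map A X f t \<longleftrightarrow> (\<exists>x. t = Inl (a, x) \<and> y \<in> f x)"
    and "Inr u \<in> Fbar_map A X f t \<longleftrightarrow> t = Inr u"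
  using assms by (auto simp: Fbar_map_def F_map_def F_obj_def)

text \<open>Evaluating the homomorphism equation at \<open>x\<close> gives an equality of two sets
  of observations. Its \<open>Inr\<close> part compares termination and its \<open>Inl\<close> part
  compares successors, so homomorphisms are characterised by determinised behaviour on
  singletons.\<close>

lemma coalg_hom_iff:
  fixes \<alpha> :: "'x \<Rightarrow> ('a, 'x) autF set" and \<beta> :: "'y \<Rightarrow> ('a, 'y) autF set"
  assumes "(X, \<alpha>) \<in> coalgs A"
  shows "f \<in> coalg_hom A (X, \<alpha>) (Y, \<beta>) \<longleftrightarrow> f \<in> kl_hom X Y \<and>
    (\<forall>x\<in>X. (det_term \<beta> (f x) \<longleftrightarrow> det_term \<alpha> {x}) \<and>
      (\<forall>a. det_step \<beta> (f x) a = kl_ext f (det_step \<alpha> {x} a)))"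
proof -
  have "(\<Union>t\<in>\<alpha> x. Fbar_map A X f t) = (\<Union>y\<in>f x. \<beta> y) \<longleftrightarrow>
      (det_term \<beta> (f x) \<longleftrightarrow> det_term \<alpha> {x}) \<and>
      (\<forall>a. det_step \<beta> (f x) a = kl_ext f (det_step \<alpha> {x} a))" (is "?L = ?M \<longleftrightarrow> _")
    if "x \<in> X" for x
  proof -
    \<comment> \<open>\<open>Fbar_map A X f\<close> is specified only on \<open>F_obj A X\<close>,
      so its arguments must be located there.\<close>
    have F: "t \<in> F_obj A X" if "t \<in> \<alpha> x" for t
      using assms \<open>x \<in> X\<close> that by (auto simp: coalgs_structure kl_hom_def)
    have Inr_L: "Inr () \<in> ?L \<longleftrightarrow> det_term \<alpha> {x}"
      using F in_Fbar_map(2)[of _ A X "()" f] by (auto simp: det_term_def)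
    have Inl_L: "Inl (a, y) \<in> ?L \<longleftrightarrow> y \<in> kl_ext f (det_step \<alpha> {x} a)" for a y
    proof -
      have "Inl (a, y) \<in> ?L \<longleftrightarrow> (\<exists>t\<in>\<alpha> x. \<exists>x'. t = Inl (a, x') \<and> y \<in> f x')"
        using F in_Fbar_map(1)[of _ A X a y f] by auto
      then show ?thesis
        by (auto simp: kl_ext_def det_step_def)
    qed
    have Inr_M: "Inr () \<in> ?M \<longleftrightarrow> det_term \<beta> (f x)"
      by (auto simp: det_term_def)
    have Inl_M: "Inl (a, y) \<in> ?M \<longleftrightarrow> y \<in> det_step \<beta> (f x) a" for a y
      by (auto simp: det_step_def)
    have split: "V = V' \<longleftrightarrow> (Inr () \<in> V' \<longleftrightarrow> Inr () \<in> V) \<and>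
        (\<forall>a y. Inl (a, y) \<in> V' \<longleftrightarrow> Inl (a, y) \<in> V)" for V V' :: "('a, 'y) autF set"
      by (simp add: set_eq_iff split_sum_all) blast
    show ?thesis
      unfolding split[of ?L ?M] Inr_L Inl_L Inr_M Inl_M by blast
  qed
  then show ?thesis
    by (auto simp: kl_comp_def restrict_def fun_eq_iff)
qed

text \<open>The criterion on singletons extends to all subsets of \<open>X\<close>:
  \<open>kl_ext\<close> and \<open>det_step\<close> preserve unions, and a union terminates iff one
  of its members does.\<close>

lemma coalg_hom_det:
  assumes "(X, \<alpha>) \<in> coalgs A" and "f \<in> coalg_hom A (X, \<alpha>) (Y, \<beta>)" and "U \<subseteq> X"
  shows det_term_hom: "det_term \<beta> (kl_ext f U) \<longleftrightarrow> det_term \<alpha> U"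
    and det_step_hom: "det_step \<beta> (kl_ext f U) a = kl_ext f (det_step \<alpha> U a)"
proof -
  have hom: "det_term \<beta> (f x) \<longleftrightarrow> det_term \<alpha> {x}"
    "det_step \<beta> (f x) a = kl_ext f (det_step \<alpha> {x} a)" if "x \<in> U" for x
    using assms(2,3) that by (auto simp: coalg_hom_iff[OF assms(1)] simp del: coalg_hom.simps)
  have "det_term \<beta> (kl_ext f U) \<longleftrightarrow> (\<exists>x\<in>U. det_term \<beta> (f x))"
    by (auto simp: det_term_def kl_ext_def)
  also have "\<dots> \<longleftrightarrow> det_term \<alpha> U"
    using hom(1) by (auto simp: det_term_def)
  finally show "det_term \<beta> (kl_ext f U) \<longleftrightarrow> det_term \<alpha> U" .
  have "det_step \<beta> (kl_ext f U) a = (\<Union>x\<in>U. det_step \<beta> (f x) a)"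
    by (auto simp: det_step_def kl_ext_def)
  also have "\<dots> = (\<Union>x\<in>U. kl_ext f (det_step \<alpha> {x} a))"
    using hom(2) by simp
  also have "\<dots> = kl_ext f (det_step \<alpha> U a)"
    by (auto simp: det_step_def kl_ext_def)
  finally show "det_step \<beta> (kl_ext f U) a = kl_ext f (det_step \<alpha> U a)" .
qed

lemma lang_eq_hom:
  assumes X: "(X, \<alpha>) \<in> coalgs A" and f: "f \<in> coalg_hom A (X, \<alpha>) (Y, \<beta>)"
  shows "lang_eq A X \<alpha> = rel_preimage X f (lang_eq A Y \<beta>)"
proof -
  \<comment> \<open>The set \<open>U\<close> varies in the induction, since reading a letter
    replaces it by a successor set, again a subset of \<open>X\<close>.\<close>
  have word: "det_term \<beta> (det_word \<beta> (kl_ext f U) w) \<longleftrightarrow> det_term \<alpha> (det_word \<alpha> U w)"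
    if "U \<subseteq> X" for U w
    using that
    by (induction w arbitrary: U)
      (simp_all add: det_term_hom[OF X f] det_step_hom[OF X f] det_step_subset[OF X])
  have "f \<in> kl_hom X Y"
    using f by simp
  then have "(U, U') \<in> lang_eq A X \<alpha> \<longleftrightarrow> (U, U') \<in> rel_preimage X f (lang_eq A Y \<beta>)" for U U'
    using word kl_ext_subset[of f X Y] by (auto simp: in_rel_preimage lang_eq_def)
  then show ?thesis
    by auto
qed

section \<open>The category of coalgebras\<close>

lemma coalg_hom_id:
  assumes "(X, \<alpha>) \<in> coalgs A"
  shows "kl_id X \<in> coalg_hom A (X, \<alpha>) (X, \<alpha>)"
  using det_step_subset[OF assms]
  by (simp add: coalg_hom_iff[OF assms] kl_id_hom kl_ext_id del: coalg_hom.simps) (simp add: kl_id_def)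

text \<open>On a singleton the composite is \<open>kl_ext g (kl_ext f {x})\<close>, so the criterion
  \<open>coalg_hom_iff\<close> follows by transferring termination and successors first along
  \<open>g\<close>, then along \<open>f\<close>.\<close>

lemma coalg_hom_comp:
  assumes X: "(X, \<alpha>) \<in> coalgs A" and Y: "(Y, \<beta>) \<in> coalgs A"
    and f: "f \<in> coalg_hom A (X, \<alpha>) (Y, \<beta>)" and g: "g \<in> coalg_hom A (Y, \<beta>) (Z, \<gamma>)"
  shows "kl_comp X g f \<in> coalg_hom A (X, \<alpha>) (Z, \<gamma>)"
proof -
  have kl: "f \<in> kl_hom X Y" "g \<in> kl_hom Y Z"
    using f g by simp_all
  have "(det_term \<gamma> (kl_comp X g f x) \<longleftrightarrow> det_term \<alpha> {x}) \<and>
      det_step \<gamma> (kl_comp X g f x) a = kl_ext (kl_comp X g f) (det_step \<alpha> {x} a)"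
    if x: "x \<in> X" for x a
  proof -
    have "kl_comp X g f x = kl_ext g (kl_ext f {x})"
      using x by (simp add: kl_comp_def kl_ext_def)
    moreover have "kl_ext f {x} \<subseteq> Y"
      using kl_ext_subset[OF kl(1)] x by simp
    ultimately show ?thesis
      using x det_step_subset[OF X]
      by (simp add: det_term_hom[OF X f] det_step_hom[OF X f] det_term_hom[OF Y g]
          det_step_hom[OF Y g] kl_ext_comp)
  qed
  then show ?thesis
    using kl_comp_hom[OF kl] by (simp add: coalg_hom_iff[OF X] del: coalg_hom.simps)
qed

lemma coalg_hom_kl_hom: "f \<in> coalg_hom A c d \<Longrightarrow> f \<in> kl_hom (fst c) (fst d)"
  by (cases c; cases d) simp

lemma category_coalg_cat: "category (coalg_cat A :: (('a, 'x) coalg, 'x \<Rightarrow> 'x set) cat)"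
proof (unfold_locales, unfold coalg_cat_def cat.simps)
  fix c d e :: "('a, 'x) coalg" and f g
  assume "c \<in> coalgs A" "d \<in> coalgs A" "f \<in> coalg_hom A c d" "g \<in> coalg_hom A d e"
  then show "kl_comp (fst c) g f \<in> coalg_hom A c e"
    by (cases c; cases d; cases e) (simp add: coalg_hom_comp del: coalg_hom.simps)
next
  fix c :: "('a, 'x) coalg"
  assume "c \<in> coalgs A"
  then show "kl_id (fst c) \<in> coalg_hom A c c"
    by (cases c) (simp add: coalg_hom_id del: coalg_hom.simps)
\<comment> \<open>The unit and associativity laws are inherited from Kleisli composition.\<close>
qed (blast intro: kl_comp_id_right kl_comp_id_left kl_comp_assoc dest: coalg_hom_kl_hom)+

section \<open>The category of coalgebras with conformances\<close>

lemma conf_hom_iff: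
  "f \<in> conf_hom A (c, R) (d, S) \<longleftrightarrow> f \<in> coalg_hom A c d \<and> R \<subseteq> rel_preimage (fst c) f S"
  by (cases c; cases d) simp

lemma rel_preimage_id: "rel_preimage X (kl_id X) R = R \<inter> (Pow X \<times> Pow X)"
  by (auto simp: in_rel_preimage kl_ext_id)

text \<open>Besides functoriality of \<open>kl_ext\<close>, this uses that \<open>kl_ext f\<close>
  lands in subsets of \<open>Y\<close>, which is the carrier condition built into the inner
  preimage.\<close>

lemma rel_preimage_comp:
  assumes "f \<in> kl_hom X Y"
  shows "rel_preimage X (kl_comp X g f) R = rel_preimage X f (rel_preimage Y g R)"
  using kl_ext_subset[OF assms] by (auto simp: in_rel_preimage kl_ext_comp)

lemma rel_preimage_mono: "R \<subseteq> S \<Longrightarrow> rel_preimage X f R \<subseteq> rel_preimage X f S"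
  by (auto simp: rel_preimage_def)

lemma conf_hom_id:
  assumes "((X, \<alpha>), R) \<in> conf_coalgs A"
  shows "kl_id X \<in> conf_hom A ((X, \<alpha>), R) ((X, \<alpha>), R)"
  using assms coalg_hom_id[of X \<alpha> A]
  by (auto simp: conf_hom_iff conf_coalgs_def conformance_def rel_preimage_id
      simp del: coalg_hom.simps conf_hom.simps)

lemma conf_hom_comp:
  assumes "((X, \<alpha>), R) \<in> conf_coalgs A" and "((Y, \<beta>), S) \<in> conf_coalgs A"
    and f: "f \<in> conf_hom A ((X, \<alpha>), R) ((Y, \<beta>), S)"
    and g: "g \<in> conf_hom A ((Y, \<beta>), S) ((Z, \<gamma>), T)"
  shows "kl_comp X g f \<in> conf_hom A ((X, \<alpha>), R) ((Z, \<gamma>), T)"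
proof -
  have "kl_comp X g f \<in> coalg_hom A (X, \<alpha>) (Z, \<gamma>)"
    using assms coalg_hom_comp[of X \<alpha> A Y \<beta> f g Z \<gamma>] by (simp add: conf_coalgs_def)
  \<comment> \<open>The inclusion of \<open>S\<close> in the preimage of \<open>T\<close> is pulled
    back along \<open>f\<close> and chained with that of \<open>R\<close> in the preimage of
    \<open>S\<close>.\<close>
  moreover have "R \<subseteq> rel_preimage X (kl_comp X g f) T"
    using f g rel_preimage_mono[of S "rel_preimage Y g T" X f] rel_preimage_comp[of f X Y g T]
    by auto
  ultimately show ?thesis
    by (simp add: conf_hom_iff del: coalg_hom.simps conf_hom.simps)
qed

lemma conf_hom_kl_hom: "f \<in> conf_hom A c d \<Longrightarrow> f \<in> kl_hom (fst (fst c)) (fst (fst d))"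
  by (cases c; cases d) (auto simp: conf_hom_iff dest: coalg_hom_kl_hom simp del: conf_hom.simps)

lemma category_conf_cat: "category (conf_cat A :: (('a, 'x) conf_coalg, 'x \<Rightarrow> 'x set) cat)"
proof (unfold_locales, unfold conf_cat_def cat.simps)
  fix c d e :: "('a, 'x) conf_coalg" and f g
  assume *: "c \<in> conf_coalgs A" "d \<in> conf_coalgs A" "f \<in> conf_hom A c d" "g \<in> conf_hom A d e"
  obtain X \<alpha> R Y \<beta> S Z \<gamma> T where "c = ((X, \<alpha>), R)" "d = ((Y, \<beta>), S)" "e = ((Z, \<gamma>), T)"
    by (metis surj_pair)
  with * show "kl_comp (fst (fst c)) g f \<in> conf_hom A c e"
    by (simp add: conf_hom_comp[of X \<alpha> R A Y \<beta> S] del: conf_hom.simps)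
next
  fix c :: "('a, 'x) conf_coalg"
  assume *: "c \<in> conf_coalgs A"
  obtain X \<alpha> R where "c = ((X, \<alpha>), R)"
    by (metis surj_pair)
  with * show "kl_id (fst (fst c)) \<in> conf_hom A c c"
    by (simp add: conf_hom_id del: conf_hom.simps)
qed (blast intro: kl_comp_id_right kl_comp_id_left kl_comp_assoc dest: conf_hom_kl_hom)+

section \<open>The behavioural conformance functor\<close>

lemma conf_hom_beh_conf:
  assumes "(X, \<alpha>) \<in> coalgs A" and "(Y, \<beta>) \<in> coalgs A" and "f \<in> coalg_hom A (X, \<alpha>) (Y, \<beta>)"
  shows "f \<in> conf_hom A ((X, \<alpha>), beh_conf A X \<alpha>) ((Y, \<beta>), beh_conf A Y \<beta>)"
  \<comment> \<open>The inclusion required of a morphism is one half of the equality in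
    \<open>lang_eq_hom\<close>.\<close>
  using assms(3) lang_eq_hom[OF assms(1,3)]
  by (simp add: conf_hom_iff beh_conf_eq_lang_eq assms(1,2) del: coalg_hom.simps conf_hom.simps)

text \<open>Both categories use the same identities and composition, and morphisms are left
  unchanged, so the functor laws are immediate. The content is that objects and morphisms land in
  \<open>conf_cat A\<close>.\<close>

lemma cat_functor_beh_conf:
  "cat_functor (coalg_cat A) (conf_cat A) (\<lambda>(Z, \<gamma>). ((Z, \<gamma>), beh_conf A Z \<gamma>)) (\<lambda>_ _ f. f)"
proof -
  interpret source: category "coalg_cat A"
    by (rule category_coalg_cat)
  interpret target: category "conf_cat A"
    by (rule category_conf_cat)
  show ?thesis
    by unfold_locales
      (auto simp: coalg_cat_def conf_cat_def conf_coalgs_def conf_hom_beh_conf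
        conformance_beh_conf
        simp del: coalg_hom.simps conf_hom.simps)
qed

theorem theorem8:
  fixes A :: "'a set" and X :: "'x set" and \<alpha> :: "'x \<Rightarrow> ('a, 'x) autF set"
  assumes "(X, \<alpha>) \<in> coalgs A"
  shows "lang_eq A X \<alpha> \<subseteq> rel_preimage X \<alpha> (lam_bar A X (lang_eq A X \<alpha>))
    \<and> (\<forall>(Y :: 'y set) \<beta>. \<forall>f. (Y, \<beta>) \<in> coalgs A \<and> f \<in> coalg_hom A (X, \<alpha>) (Y, \<beta>) \<longrightarrow>
         lang_eq A X \<alpha> = rel_preimage X f (lang_eq A Y \<beta>))
    \<and> (\<forall>(Z :: 'u set) \<gamma>. (Z, \<gamma>) \<in> coalgs A \<longrightarrow>
         conformance A Z \<gamma> (beh_conf A Z \<gamma>) \<and>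
         (\<forall>R. conformance A Z \<gamma> R \<longrightarrow> R \<subseteq> beh_conf A Z \<gamma>))
    \<and> cat_functor (coalg_cat A :: (('a, 'u) coalg, 'u \<Rightarrow> 'u set) cat) (conf_cat A)
         (\<lambda>(Z, \<gamma>). ((Z, \<gamma>), beh_conf A Z \<gamma>)) (\<lambda>_ _ f. f)"
  by (intro conjI allI impI; (elim conjE)?)
    (use assms in \<open>simp_all add: lang_eq_subset_preimage lang_eq_hom[OF assms]
      conformance_lang_eq conformance_subset_lang_eq beh_conf_eq_lang_eq cat_functor_beh_conf
      del: coalg_hom.simps\<close>)

end
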